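(* Let $G=(S,T;E)$ with $S=\{s_1,\dots,s_n\}$, $w:E\to\mathbb R_+$ and $d\in\mathbb Z_+$. Choose $k\in\{d-1,\dots,3d-3\}$ such that $2d-1$ divides $n+k$, add $k$ new isolated nodes $s_{n+1},\dots,s_{n+k}$ to $S$, and regard $s_1,\dots,s_{n+k}$ in cyclic order (indices taken modulo $n+k$). For each $j$ let $H_j$ be the subgraph induced by $\{s_j,s_{j+1},\dots,s_{j+d-1}\}\cup T$ (cyclic indices) and let $F_j$ be a maximum-weight matching of $H_j$ with respect to $w$. For $i=1,\dots,2d-1$ let $M_i=\bigcup_{j=0}^{\frac{n+k}{2d-1}-1}F_{i+j(2d-1)}$, and let $i^*\in\arg\max\{w(M_i): i=1,\dots,2d-1\}$. Then $M_{i^*}$ is a $d$-distance matching of $G$ and $w(M^* )\le\left(2-\frac1d\right)w(M_{i^*})$ for every $d$-distance matching $M^*$ of $G$.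
   Context: $G$ is a finite bipartite graph without loops or parallel edges; the nodes of $S$ are in the fixed order $s_1,\dots,s_n$. A $d$-distance matching is a subset $M\subseteq E$ such that every node of $S$ is incident to at most one edge of $M$, and whenever $s_it,s_jt\in M$ with $i\ne j$, $t\in T$, we have $|j-i|\ge d$; $w(M)=\sum_{e\in M}w(e)$. *)

theory Defs
  imports Complex_Main
begin

text \<open>
  Graphs are given by their node set and a set of edges, each edge being the set of its two end
  nodes. Loops and parallel edges are therefore excluded, and nodes in no edge are isolated.
\<close>

definition bipartite_graph :: "'v set \<Rightarrow> 'v set \<Rightarrow> 'v set set \<Rightarrow> bool" where
  "bipartite_graph S T E \<longleftrightarrow>
     finite S \<and> finite T \<and> S \<inter> T = {} \<and> (\<forall>e\<in>E. \<exists>u\<in>S. \<exists>t\<in>T. e = {u, t})"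

definition induced_edges :: "'v set set \<Rightarrow> 'v set \<Rightarrow> 'v set set" where
  "induced_edges E X = {e \<in> E. e \<subseteq> X}"

definition matching :: "'v set set \<Rightarrow> 'v set set \<Rightarrow> bool" where
  "matching E M \<longleftrightarrow> M \<subseteq> E \<and> (\<forall>e\<in>M. \<forall>f\<in>M. e \<noteq> f \<longrightarrow> e \<inter> f = {})"

definition max_weight_matching ::
  "('v set \<Rightarrow> real) \<Rightarrow> 'v set set \<Rightarrow> 'v set set \<Rightarrow> bool" where
  "max_weight_matching w E F \<longleftrightarrow>
     matching E F \<and> (\<forall>M. matching E M \<longrightarrow> sum w M \<le> sum w F)"

definition distance_matching ::
  "(nat \<Rightarrow> 'v) \<Rightarrow> nat \<Rightarrow> 'v set \<Rightarrow> 'v set set \<Rightarrow> nat \<Rightarrow> 'v set set \<Rightarrow> bool" where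
  "distance_matching s n T E d M \<longleftrightarrow>
     M \<subseteq> E \<and>
     (\<forall>i\<in>{1..n}. card {e \<in> M. s i \<in> e} \<le> 1) \<and>
     (\<forall>i\<in>{1..n}. \<forall>j\<in>{1..n}. \<forall>t\<in>T.
        i \<noteq> j \<and> {s i, t} \<in> M \<and> {s j, t} \<in> M \<longrightarrow> int d \<le> \<bar>int j - int i\<bar>)"

text \<open>
  Representative in \<open>{1..N}\<close> of an index \<open>i \<ge> 1\<close> modulo \<open>N \<ge> 1\<close>.
\<close>

definition cyc :: "nat \<Rightarrow> nat \<Rightarrow> nat" where
  "cyc N i = Suc ((i - 1) mod N)"

definition cyclic_window :: "(nat \<Rightarrow> 'v) \<Rightarrow> nat \<Rightarrow> nat \<Rightarrow> nat \<Rightarrow> 'v set" where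
  "cyclic_window s N d j = {s (cyc N i) | i. j \<le> i \<and> i < j + d}"

end

theory Submission imports Defs begin

text \<open>
  Nodes of distinct windows of the same \<open>M\<^sub>i\<close> are at distance at least \<open>(2 * d - 1) - (d - 1) = d\<close>,
  even cyclically, so every \<open>M\<^sub>i\<close> is a \<open>d\<close>-distance matching whose weight is the total weight of its
  parts \<open>F\<^sub>j\<close>. Conversely, as \<open>k \<ge> d - 1\<close>, a window never contains both a node near \<open>s\<^sub>n\<close> and one
  near \<open>s\<^sub>1\<close>, so a \<open>d\<close>-distance matching \<open>M\<^sup>*\<close> restricts to a matching of every \<open>H\<^sub>j\<close>. Every node
  lies in \<open>d\<close> windows, whence
  \<open>d * w(M\<^sup>*) \<le> \<Sum>\<^sub>j w(F\<^sub>j) = \<Sum>\<^sub>i w(M\<^sub>i) \<le> (2 * d - 1) * max\<^sub>i w(M\<^sub>i)\<close>.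
\<close>

section \<open>Cyclic indices and windows\<close>

lemma cyc_id: "1 \<le> i \<Longrightarrow> i \<le> N \<Longrightarrow> cyc N i = i"
  by (simp add: cyc_def)

lemma cyc_add: "1 \<le> i \<Longrightarrow> i \<le> N \<Longrightarrow> cyc N (i + N) = i"
  by (cases i) (simp_all add: cyc_def)

lemma cyc_mem: "0 < N \<Longrightarrow> cyc N i \<in> {1..N}"
  by (simp add: cyc_def Suc_leI)

text \<open>The multiple of \<open>N\<close> is exposed as an integer so that differences of
  representatives become linear; \<open>1 \<le> i\<close> makes the truncated \<open>i - 1\<close>
  exact.\<close>

lemma cyc_cong:
  assumes "1 \<le> i"
  obtains c :: int where "int (cyc N i) = int i + c * int N"
proof
  have "int i - 1 = int (i - 1)"
    using assms by simp
  also have "\<dots> = int ((i - 1) div N) * int N + int ((i - 1) mod N)"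
    by (metis div_mult_mod_eq of_nat_add of_nat_mult)
  finally show "int (cyc N i) = int i + (- int ((i - 1) div N)) * int N"
    by (simp add: cyc_def)
qed

text \<open>The representatives differ by a nonzero multiple of \<open>2 * d - 1\<close> plus a
  difference of offsets, which is at most \<open>d - 1\<close> in absolute value.\<close>

lemma window_gap:
  fixes d q i j j' x x' :: nat
  assumes "1 \<le> i" "j < q" "j' < q" "j \<noteq> j'"
    and x: "i + j * (2 * d - 1) \<le> x" "x < i + j * (2 * d - 1) + d"
    and x': "i + j' * (2 * d - 1) \<le> x'" "x' < i + j' * (2 * d - 1) + d"
  shows "int d \<le> \<bar>int (cyc (q * (2 * d - 1)) x) - int (cyc (q * (2 * d - 1)) x')\<bar>"
proof -
  define m where "m = 2 * d - 1"
  \<comment> \<open>The window is nonempty, so \<open>d \<ge> 1\<close> and the truncated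
    subtraction is exact.\<close>
  have m: "int m = 2 * int d - 1"
    using x by (auto simp: m_def)
  obtain c where c: "int (cyc (q * m) x) = int x + c * int (q * m)"
    using cyc_cong[of x] x \<open>1 \<le> i\<close> by (metis add_leD1 le_trans)
  obtain c' where c': "int (cyc (q * m) x') = int x' + c' * int (q * m)"
    using cyc_cong[of x'] x' \<open>1 \<le> i\<close> by (metis add_leD1 le_trans)
  define r where "r = (int x - int (i + j * m)) - (int x' - int (i + j' * m))"
  define z where "z = int j - int j' + (c - c') * int q"
  \<comment> \<open>\<open>j\<close> and \<open>j'\<close> are distinct and below \<open>q\<close>,
    hence incongruent modulo \<open>q\<close>.\<close>
  have "z \<noteq> 0"
  proof
    assume "z = 0"
    then have "int q dvd int j - int j'"
      by (metis z_def add.inverse_inverse add_eq_0_iff dvd_minus_iff dvd_triv_right)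
    then show False
      using assms(2-4) zdvd_imp_le[of "int q" "\<bar>int j - int j'\<bar>"] by auto
  qed
  then have "int m * 1 \<le> int m * \<bar>z\<bar>"
    by (intro mult_left_mono) auto
  then have "int m \<le> \<bar>int m * z\<bar>"
    by (simp add: abs_mult)
  moreover have "\<bar>r\<bar> \<le> int d - 1"
    using x x' unfolding r_def m_def by linarith
  moreover have "int (cyc (q * m) x) - int (cyc (q * m) x') = int m * z + r"
    unfolding c c' z_def r_def by (simp add: algebra_simps)
  ultimately show ?thesis
    using m unfolding m_def by linarith
qed

text \<open>A window that holds an index at most \<open>n\<close> before wrapping starts at or below
  \<open>n\<close>, so it ends by \<open>n + d - 1 \<le> N\<close> and does not wrap. Hence
  \<open>x\<close> and \<open>y\<close> lie on the same side of \<open>N\<close>.\<close>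

lemma window_no_wrap:
  assumes "1 \<le> j" "j \<le> N" "n + d \<le> N + 1"
    and x: "j \<le> x" "x < j + d" "cyc N x \<le> n"
    and y: "j \<le> y" "y < j + d" "cyc N y \<le> n"
  shows "\<bar>int (cyc N x) - int (cyc N y)\<bar> < int d"
proof -
  \<comment> \<open>At most one wrap occurs: \<open>n = 0\<close> contradicts
    \<open>cyc N x \<le> n\<close>, and otherwise \<open>d \<le> N\<close> gives
    \<open>v < 2 * N\<close>.\<close>
  have cyc: "cyc N v = (if v \<le> N then v else v - N)" if "j \<le> v" "v < j + d" for v
  proof (cases "n = 0")
    case True
    then show ?thesis
      using x by (simp add: cyc_def)
  next
    case False
    then show ?thesis
      using that assms(1-3) cyc_id[of v N] cyc_add[of "v - N" N] by auto
  qed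
  show ?thesis
    using assms cyc[OF x(1,2)] cyc[OF y(1,2)] by (auto split: if_splits)
qed

lemma card_windows_ge:
  assumes "d \<le> N" "i \<in> {1..N}"
  shows "d \<le> card {j \<in> {1..N}. s i \<in> cyclic_window s N d j}"
proof -
  \<comment> \<open>\<open>g p\<close> is the start, reduced to \<open>{1..N}\<close>, of the window
    that has \<open>s i\<close> at offset \<open>p\<close>.\<close>
  define g where "g p = (if p < i then i - p else i + N - p)" for p
  have "inj_on g {..<d}"
    using assms by (auto simp: inj_on_def g_def split: if_splits)
  moreover have "g ` {..<d} \<subseteq> {j \<in> {1..N}. s i \<in> cyclic_window s N d j}"
  proof safe
    fix p assume p: "p < d"
    show "g p \<in> {1..N}"
      using assms p by (auto simp: g_def)
    have "cyc N (g p + p) = i"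
      using assms p cyc_id[of i N] cyc_add[of i N] by (auto simp: g_def)
    then show "s i \<in> cyclic_window s N d (g p)"
      unfolding cyclic_window_def using p by (intro CollectI exI[of _ "g p + p"]) auto
  qed
  ultimately show ?thesis
    using card_inj_on_le[of g "{..<d}"] by fastforce
qed

text \<open>Groups window starts by residue modulo \<open>m\<close>, which turns a sum over all
  \<open>F j\<close> into a sum over all \<open>M i\<close>.\<close>

lemma sum_residue_classes:
  fixes f :: "nat \<Rightarrow> 'a::comm_monoid_add"
  shows "(\<Sum>i\<in>{1..m}. \<Sum>j<q. f (i + j * m)) = sum f {1..q * m}"
proof -
  have "(\<Sum>i\<in>{1..m}. \<Sum>j<q. f (i + j * m)) = (\<Sum>j<q. \<Sum>i\<in>{1..m}. f (i + j * m))"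
    by (rule sum.swap)
  also have "\<dots> = (\<Sum>j<q. \<Sum>x\<in>{j * m..<j * m + m}. f (Suc x))"
  proof (rule sum.cong[OF refl])
    fix j
    show "(\<Sum>i\<in>{1..m}. f (i + j * m)) = (\<Sum>x\<in>{j * m..<j * m + m}. f (Suc x))"
      by (intro sum.reindex_bij_witness[of _ "\<lambda>x. Suc x - j * m" "\<lambda>i. i + j * m - 1"]) auto
  qed
  also have "\<dots> = (\<Sum>x<q * m. f (Suc x))"
    by (rule sum.nat_group)
  also have "\<dots> = sum f {1..q * m}"
    by (intro sum.reindex_bij_witness[of _ "\<lambda>x. x - 1" Suc]) auto
  finally show ?thesis .
qed

section \<open>Edges inside a window\<close>

lemma bipartite_finite_edges:
  assumes "bipartite_graph S T E"
  shows "finite E"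
proof -
  have "E \<subseteq> (\<lambda>(u, t). {u, t}) ` (S \<times> T)"
    using assms unfolding bipartite_graph_def by fastforce
  then show ?thesis
    using assms unfolding bipartite_graph_def by (meson finite_SigmaI finite_imageI finite_subset)
qed

text \<open>\<open>s\<close> is injective on old and new indices together, so a window position
  whose node lies in \<open>S\<close> has its representative in \<open>{1..n}\<close>.\<close>

lemma window_edgeE:
  assumes "bipartite_graph S T E" "S = s ` {1..n}" "inj_on s {1..N}" "n \<le> N" "0 < N"
    and e: "e \<in> induced_edges E (cyclic_window s N d j \<union> T)"
  obtains x t where "e = {s (cyc N x), t}" "t \<in> T" "j \<le> x" "x < j + d" "cyc N x \<in> {1..n}"
proof -
  have "S \<inter> T = {}" "e \<in> E"
    using assms(1) e by (simp_all add: bipartite_graph_def induced_edges_def)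
  moreover from this obtain u t where ut: "u \<in> S" "t \<in> T" "e = {u, t}"
    using assms(1) unfolding bipartite_graph_def by meson
  ultimately have "u \<in> cyclic_window s N d j"
    using e by (auto simp: induced_edges_def)
  then obtain x where x: "u = s (cyc N x)" "j \<le> x" "x < j + d"
    by (auto simp: cyclic_window_def)
  obtain a where a: "a \<in> {1..n}" "u = s a"
    using ut assms(2) by blast
  have "cyc N x = a"
    using assms(3,4) a x(1) cyc_mem[OF \<open>0 < N\<close>, of x] by (auto dest: inj_onD)
  then show thesis
    using that[of x t] ut x a by simp
qed

text \<open>Distinct edges of \<open>M\<close> have distinct ends in \<open>S\<close>; inside one
  window these ends are less than \<open>d\<close> apart, so the edges cannot share an end in
  \<open>T\<close>.\<close>

lemma distance_matching_window:
  assumes "bipartite_graph S T E" "S = s ` {1..n}" "inj_on s {1..N}" "n \<le> N" "0 < N"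
    and "j \<in> {1..N}" "n + d \<le> N + 1"
    and M: "distance_matching s n T E d M"
  defines "H \<equiv> induced_edges E (cyclic_window s N d j \<union> T)"
  shows "matching H (M \<inter> H)"
  unfolding matching_def
proof (intro conjI ballI impI)
  fix e f assume e: "e \<in> M \<inter> H" and f: "f \<in> M \<inter> H" and "e \<noteq> f"
  obtain x t where x: "e = {s (cyc N x), t}" "t \<in> T" "j \<le> x" "x < j + d" "cyc N x \<in> {1..n}"
    using window_edgeE[OF assms(1-5)] e unfolding H_def by blast
  obtain y t' where y: "f = {s (cyc N y), t'}" "t' \<in> T" "j \<le> y" "y < j + d" "cyc N y \<in> {1..n}"
    using window_edgeE[OF assms(1-5)] f unfolding H_def by blast
  have "M \<subseteq> E" and card: "card {e \<in> M. s (cyc N x) \<in> e} \<le> Suc 0"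
    using M x(5) by (simp_all add: distance_matching_def)
  \<comment> \<open>An infinite set has \<open>card\<close> 0, so the bound on \<open>card\<close>
    excludes a second edge only once finiteness is known.\<close>
  then have "finite M"
    using bipartite_finite_edges[OF assms(1)] finite_subset by blast
  then have "finite {e \<in> M. s (cyc N x) \<in> e}"
    by simp
  then have s_neq: "s (cyc N x) \<noteq> s (cyc N y)"
    using card e f x(1) y(1) \<open>e \<noteq> f\<close> by (auto simp: card_le_Suc0_iff_eq)
  have "\<bar>int (cyc N y) - int (cyc N x)\<bar> < int d"
    using window_no_wrap[of j N n d y x] assms(6,7) x y by simp
  then have "t \<noteq> t'"
    using M e f x y s_neq unfolding distance_matching_def by (metis IntD1 not_less)
  moreover have "S \<inter> T = {}"
    using assms(1) by (simp add: bipartite_graph_def)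
  ultimately show "e \<inter> f = {}"
    using x y s_neq \<open>S = s ` {1..n}\<close> by blast
qed auto

theorem theorem7:
  fixes S T :: "'v set"
    and E :: "'v set set"
    and s :: "nat \<Rightarrow> 'v"
    and w :: "'v set \<Rightarrow> real"
    and n d k i_star :: nat
    and F M :: "nat \<Rightarrow> 'v set set"
  assumes graph: "bipartite_graph S T E"
    and order_S: "bij_betw s {1..n} S"
    and w_nonneg: "\<And>e. e \<in> E \<Longrightarrow> 0 \<le> w e"
    and d_pos: "d \<ge> 1"
    and k_range: "k \<in> {d - 1..3 * d - 3}"
    and k_dvd: "(2 * d - 1) dvd (n + k)"
    and new_distinct: "inj_on s {n + 1..n + k}"
    and new_fresh: "s ` {n + 1..n + k} \<inter> (S \<union> T) = {}"
    and F_max: "\<And>j. j \<in> {1..n + k} \<Longrightarrow>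
      max_weight_matching w (induced_edges E (cyclic_window s (n + k) d j \<union> T)) (F j)"
    and M_def: "\<And>i. i \<in> {1..2 * d - 1} \<Longrightarrow>
      M i = (\<Union>j\<in>{0..<(n + k) div (2 * d - 1)}. F (i + j * (2 * d - 1)))"
    and i_star: "is_arg_max (\<lambda>i. sum w (M i)) (\<lambda>i. i \<in> {1..2 * d - 1}) i_star"
  shows "distance_matching s n T E d (M i_star) \<and>
    (\<forall>M_opt. distance_matching s n T E d M_opt \<longrightarrow>
       sum w M_opt \<le> (2 - 1 / real d) * sum w (M i_star))"
proof -
  define N where "N = n + k"
  define m where "m = 2 * d - 1"
  define q where "q = N div m"
  define H where "H j = induced_edges E (cyclic_window s N d j \<union> T)" for j
  have N: "N = q * m"
    using k_dvd by (simp add: N_def m_def q_def)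
  have fin: "finite E"
    using bipartite_finite_edges[OF graph] .
  have S: "S = s ` {1..n}"
    using order_S by (auto simp: bij_betw_def)
  have ST: "S \<inter> T = {}"
    using graph by (simp add: bipartite_graph_def)
  have edge: "\<exists>a\<in>{1..n}. \<exists>t\<in>T. e = {s a, t}" if "e \<in> E" for e
    using graph that unfolding bipartite_graph_def S by simp
  have "{1..N} = {1..n} \<union> {n + 1..n + k}"
    by (auto simp: N_def)
  then have inj: "inj_on s {1..N}"
    using order_S new_distinct new_fresh S unfolding bij_betw_def by (auto simp: inj_on_Un)
  have nN: "n \<le> N" "n + d \<le> N + 1"
    using k_range by (auto simp: N_def)
  have i_star_mem: "i_star \<in> {1..m}"
    using i_star by (auto simp: is_arg_max_linorder m_def)
  have i_star_max: "sum w (M i) \<le> sum w (M i_star)" if "i \<in> {1..m}" for i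
    using i_star that by (simp add: is_arg_max_linorder m_def)
  \<comment> \<open>No start exceeds \<open>q * m = N\<close>, so \<open>F_max\<close> applies to
    every part of \<open>M i\<close> without reducing indices.\<close>
  have index: "i + j * m \<in> {1..N}" if "i \<in> {1..m}" "j < q" for i j
  proof -
    have "i + j * m \<le> Suc j * m"
      using that by simp
    also have "\<dots> \<le> N"
      unfolding N using that by (intro mult_le_mono1) simp
    finally show ?thesis
      using that by simp
  qed
  have M_eq: "M i = (\<Union>j<q. F (i + j * m))" if "i \<in> {1..m}" for i
    using M_def[of i] that by (simp add: m_def q_def N_def lessThan_atLeast0)
  have F: "max_weight_matching w (H j) (F j)" if "j \<in> {1..N}" for j
    using F_max that unfolding N_def H_def by blast
  have F_sub: "F j \<subseteq> H j" if "j \<in> {1..N}" for j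
    using F[OF that] by (auto simp: max_weight_matching_def matching_def)
  have H_sub: "H j \<subseteq> E" for j
    by (auto simp: H_def induced_edges_def)
  have F_meet: "e = f" if "j \<in> {1..N}" "e \<in> F j" "f \<in> F j" "v \<in> e" "v \<in> f" for j e f v
    using F[OF that(1)] that unfolding max_weight_matching_def matching_def by blast
  have F_node: "\<exists>x. j \<le> x \<and> x < j + d \<and> cyc N x = a"
    if j: "j \<in> {1..N}" "e \<in> F j" and a: "a \<in> {1..n}" "s a \<in> e" for j e a
  proof -
    have "e \<in> induced_edges E (cyclic_window s N d j \<union> T)" "0 < N"
      using j F_sub unfolding H_def by auto
    then obtain x t where x: "e = {s (cyc N x), t}" "t \<in> T" "j \<le> x" "x < j + d"
        "cyc N x \<in> {1..n}"
      by (elim window_edgeE[OF graph S inj nN(1), rotated])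
    have "s a \<noteq> t"
      using a x(2) S ST by blast
    then have "s (cyc N x) = s a"
      using x(1) a(2) by auto
    then have "cyc N x = a"
      using inj a(1) x(5) nN(1) by (auto dest: inj_onD)
    then show ?thesis
      using x by blast
  qed
  \<comment> \<open>The case \<open>a = b\<close> is included: with \<open>d \<ge> 1\<close> it
    shows that different parts of \<open>M i\<close> share no node of \<open>S\<close>.\<close>
  have F_gap: "int d \<le> \<bar>int b - int a\<bar>"
    if i: "i \<in> {1..m}" "j < q" "j' < q" "j \<noteq> j'"
      and e: "e \<in> F (i + j * m)" "a \<in> {1..n}" "s a \<in> e"
      and f: "f \<in> F (i + j' * m)" "b \<in> {1..n}" "s b \<in> f" for i j j' e f a b
  proof -
    obtain x where x: "i + j * m \<le> x" "x < i + j * m + d" "cyc N x = a"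
      using F_node[OF index[OF i(1,2)] e] by blast
    obtain y where y: "i + j' * m \<le> y" "y < i + j' * m + d" "cyc N y = b"
      using F_node[OF index[OF i(1,3)] f] by blast
    show ?thesis
      using window_gap[of i j' q j d y x] i x y unfolding N m_def by simp
  qed
  have M_sub: "M i \<subseteq> E" if "i \<in> {1..m}" for i
    using M_eq[OF that] F_sub[OF index[OF that]] H_sub by blast

  \<comment> \<open>Feasibility and weight of each \<open>M i\<close>\<close>
  have "distance_matching s n T E d (M i)" if i: "i \<in> {1..m}" for i
    unfolding distance_matching_def
  proof (intro conjI ballI impI)
    show "M i \<subseteq> E"
      using M_sub[OF i] .
  next
    fix a assume a: "a \<in> {1..n}"
    have "e = f" if ef: "e \<in> M i" "f \<in> M i" "s a \<in> e" "s a \<in> f" for e f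
    proof -
      obtain j j' where j: "j < q" "e \<in> F (i + j * m)" and j': "j' < q" "f \<in> F (i + j' * m)"
        using ef(1,2) unfolding M_eq[OF i] by blast
      have "j = j'"
        using F_gap[OF i j(1) j'(1) _ j(2) a ef(3) j'(2) a ef(4)] d_pos by auto
      then show ?thesis
        using F_meet[OF index[OF i j(1)] j(2)] j' ef by blast
    qed
    moreover have "finite {e \<in> M i. s a \<in> e}"
      using M_sub[OF i] fin by (simp add: finite_subset)
    ultimately show "card {e \<in> M i. s a \<in> e} \<le> 1"
      using card_le_Suc0_iff_eq[of "{e \<in> M i. s a \<in> e}"] by auto
  next
    fix a b t assume a: "a \<in> {1..n}" and b: "b \<in> {1..n}" and "t \<in> T"
      and M: "a \<noteq> b \<and> {s a, t} \<in> M i \<and> {s b, t} \<in> M i"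
    obtain j j' where j: "j < q" "{s a, t} \<in> F (i + j * m)"
      and j': "j' < q" "{s b, t} \<in> F (i + j' * m)"
      using M unfolding M_eq[OF i] by blast
    have "s a \<noteq> s b"
      using M a b inj nN(1) by (auto dest: inj_onD)
    moreover have "s a \<noteq> t" "s b \<noteq> t"
      using a b ST \<open>t \<in> T\<close> unfolding S by blast+
    ultimately have "{s a, t} \<noteq> {s b, t}"
      by (simp add: doubleton_eq_iff)
    \<comment> \<open>Within one part, two edges meeting in \<open>t\<close> would coincide.\<close>
    then have "j \<noteq> j'"
      using F_meet[OF index[OF i j(1)] j(2), of "{s b, t}" t] j' by auto
    then show "int d \<le> \<bar>int b - int a\<bar>"
      using F_gap[OF i j(1) j'(1) _ j(2) a _ j'(2) b] by simp
  qed
  moreover have w_M: "sum w (M i) = (\<Sum>j<q. sum w (F (i + j * m)))" if i: "i \<in> {1..m}" for i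
    unfolding M_eq[OF i]
  proof (intro sum.UNION_disjoint ballI impI)
    fix j assume "j \<in> {..<q}"
    then show "finite (F (i + j * m))"
      using F_sub[OF index[OF i]] H_sub fin by (meson finite_subset lessThan_iff subset_trans)
  next
    fix j j' assume j: "j \<in> {..<q}" "j' \<in> {..<q}" "j \<noteq> j'"
    \<comment> \<open>A common edge would put its end in \<open>S\<close> at distance at least
      \<open>d\<close> from itself.\<close>
    have False if e: "e \<in> F (i + j * m)" "e \<in> F (i + j' * m)" for e
    proof -
      have "e \<in> E"
        using M_sub[OF i] M_eq[OF i] e j by auto
      then obtain a where "a \<in> {1..n}" "s a \<in> e"
        using edge by blast
      then show False
        using F_gap[OF i, of j j' e a e a] j e d_pos by auto
    qed
    then show "F (i + j * m) \<inter> F (i + j' * m) = {}"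
      by blast
  qed simp

  \<comment> \<open>Double counting of edges and windows\<close>
  moreover have "sum w X \<le> (2 - 1 / real d) * sum w (M i_star)"
    if X: "distance_matching s n T E d X" for X
  proof -
    have XE: "X \<subseteq> E" "finite X"
      using X fin by (auto simp: distance_matching_def intro: finite_subset)
    have "real d * w e \<le> (\<Sum>j | j \<in> {1..N} \<and> e \<in> H j. w e)" if "e \<in> X" for e
    proof -
      have "e \<in> E"
        using that XE by blast
      then obtain a t where a: "a \<in> {1..n}" "t \<in> T" "e = {s a, t}"
        using edge by blast
      have "{j \<in> {1..N}. s a \<in> cyclic_window s N d j} \<subseteq> {j \<in> {1..N}. e \<in> H j}"
        using a \<open>e \<in> E\<close> by (auto simp: H_def induced_edges_def)
      then have "card {j \<in> {1..N}. s a \<in> cyclic_window s N d j} \<le> card {j \<in> {1..N}. e \<in> H j}"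
        by (intro card_mono) auto
      \<comment> \<open>The index \<open>a\<close> witnesses \<open>n \<ge> 1\<close>, so
        \<open>n + d \<le> N + 1\<close> yields \<open>d \<le> N\<close>.\<close>
      moreover have "d \<le> card {j \<in> {1..N}. s a \<in> cyclic_window s N d j}"
        using a nN by (intro card_windows_ge) auto
      ultimately have "real d \<le> real (card {j \<in> {1..N}. e \<in> H j})"
        by linarith
      then show ?thesis
        using w_nonneg[OF \<open>e \<in> E\<close>] by (simp add: mult_right_mono)
    qed
    then have "real d * sum w X \<le> (\<Sum>e\<in>X. \<Sum>j | j \<in> {1..N} \<and> e \<in> H j. w e)"
      unfolding sum_distrib_left by (rule sum_mono)
    also have "\<dots> = (\<Sum>j\<in>{1..N}. \<Sum>e | e \<in> X \<and> e \<in> H j. w e)"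
      using XE by (intro sum.swap_restrict) auto
    also have "\<dots> \<le> (\<Sum>j\<in>{1..N}. sum w (F j))"
    proof (intro sum_mono)
      fix j assume j: "j \<in> {1..N}"
      then have "matching (H j) (X \<inter> H j)"
        unfolding H_def by (intro distance_matching_window[OF graph S inj nN(1) _ j nN(2) X]) auto
      then show "(\<Sum>e | e \<in> X \<and> e \<in> H j. w e) \<le> sum w (F j)"
        using F[OF j] by (simp add: max_weight_matching_def Int_def)
    qed
    also have "\<dots> = (\<Sum>i\<in>{1..m}. sum w (M i))"
      unfolding N sum_residue_classes[symmetric] using w_M by simp
    also have "\<dots> \<le> real m * sum w (M i_star)"
      using sum_bounded_above[of "{1..m}" "\<lambda>i. sum w (M i)"] i_star_max by simp
    \<comment> \<open>The factor \<open>d\<close> is pulled out of \<open>2 * d - 1\<close> to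
      cancel against the one on the left of the chain.\<close>
    also have "real m = real d * (2 - 1 / real d)"
      using d_pos by (simp add: m_def field_simps of_nat_diff)
    finally show ?thesis
      using d_pos by (simp add: mult.assoc)
  qed
  ultimately show ?thesis
    using i_star_mem by blast
qed

end
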